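(* Consider the eight $\square_q$-module structures III, IIIS, IIIT, IIIST, IV, IVS, IVT, IVST on the vector space $U$ listed in the context. The elements $x_1$ and $x_3$ act on the algebra $U$ (whose product is the $q$-shuffle product $\star$) as derivations of the following sort: \begin{itemize} \item for III and IV: $x_1$ acts as a $(K,I)$-derivation and $x_3$ acts as a $(K^{-1},I)$-derivation; \item for IIIS and IVS: $x_1$ acts as an $(I,K)$-derivation and $x_3$ acts as an $(I,K^{-1})$-derivation; \item for IIIT and IVT: $x_1$ acts as a $(K^{-1},I)$-derivation and $x_3$ acts as a $(K,I)$-derivation; \item for IIIST and IVST: $x_1$ acts as an $(I,K^{-1})$-derivation and $x_3$ acts as an $(I,K)$-derivation. \end{itemize}
   Context: Throughout, $\mathbb F$ is a field and $q\in\mathbb F$ is nonzero and not a root of unity. All vector spaces and algebras are over $\mathbb F$; algebras are associative with multiplicative identity. $[3]_q=(q^3-q^{-3})/(q-q^{-1})$ and $Q=1-q^2$. For an algebra $\mathcal A$ and automorphisms $\varphi,\phi$ of $\mathcal A$, a $(\varphi,\phi)$-derivation of $\mathcal A$ is an $\mathbb F$-linear map $\delta:\mathcal A\to\mathcal A$ such that for all $u,v\in\mathcal A$ (with juxtaposition the product of $\mathcal A$) $\delta(uv)=\varphi(u)\delta(v)+\delta(u)\phi(v)$. $I$ is the identity map. The algebra $\square_q$ is defined by generators $\{x_i\}_{i\in\mathbb Z_4}$ ($\mathbb Z_4=\mathbb Z/4\mathbb Z$) and relations, for $i\in\mathbb Z_4$: $\frac{q x_ix_{i+1}-q^{-1}x_{i+1}x_i}{q-q^{-1}}=1$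 and $x_i^3x_{i+2}-[3]_q x_i^2x_{i+2}x_i+[3]_q x_ix_{i+2}x_i^2-x_{i+2}x_i^3=0$. Let $\mathbb V$ be the free algebra on two generators $A,B$. A word of length $n$ is a product $v_1v_2\cdots v_n$ with each $v_i\in\{A,B\}$ (the word of length $0$ is $1$); the words form the standard basis of $\mathbb V$. Let $(\,,\,)$ be the bilinear form on $\mathbb V$ for which the words are orthonormal. ${\rm End}(\mathbb V)$ is the algebra of $\mathbb F$-linear maps $\mathbb V\to\mathbb V$ whose matrix with respect to the standard basis has finitely many nonzero entries in each row; each $X\in{\rm End}(\mathbb V)$ has a unique adjoint $X^*\in{\rm End}(\mathbb V)$ with $(Xu,v)=(u,X^*v)$ for all $u,v\in\mathbb V$. $K$ is the automorphism of the free algebra $\mathbb V$ with $A\mapsto q^2A$, $B\mapsto q^{-2}B$. Define $A_L(v)=Av$, $B_L(v)=Bv$, $A_R(v)=vA$, $B_R(v)=vB$ for $v\in\mathbb V$. Put $\langle A,A\rangle=\langle B,B\rangle=2$, $\langle A,B\rangle=\langle B,A\rangle=-2$. The $q$-shuffle product $\star$ is the associative bilinear product on $\mathbb V$ with $1\star v=v\star1=v$ and, recursively for nontrivial words $u=u_1\cdots u_r$, $v=v_1\cdots v_s$, $u\star v=u_1\bigl((u_2\cdots u_r)\star v\bigr)+v_1\bigl(u\star(v_2\cdots v_s)\bigr)q^{\langle u_1,v_1\rangle+\langle u_2,v_1\rangle+\cdots+\langle u_r,v_1\rangle}$. The vector space $\mathbb V$ with product $\star$ is the $q$-shuffle algebra;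 $K$ is also an automorphism of the $q$-shuffle algebra. Define $A_\ell(v)=A\star v$, $B_\ell(v)=B\star v$, $A_r(v)=v\star A$, $B_r(v)=v\star B$ for $v\in\mathbb V$. $U$ is the subalgebra of the $q$-shuffle algebra $\mathbb V$ generated by $A,B$. It is invariant under $K^{\pm1},A_\ell,B_\ell,A_r,B_r,A^*_L,B^*_L,A^*_R,B^*_R$, so these maps act on $U$ (with the same notation). The $\square_q$-module structures on $U$ are as follows ($x_0,x_1,x_2,x_3$ act respectively as the listed maps). III: $A_\ell,\ Q(A^*_L-B^*_RK),\ B_\ell,\ Q(B^*_L-A^*_RK^{-1})$. IIIS: $A_r,\ Q(A^*_R-B^*_LK),\ B_r,\ Q(B^*_R-A^*_LK^{-1})$. IIIT: $B_\ell,\ Q(B^*_L-A^*_RK^{-1}),\ A_\ell,\ Q(A^*_L-B^*_RK)$. IIIST: $B_r,\ Q(B^*_R-A^*_LK^{-1}),\ A_r,\ Q(A^*_R-B^*_LK)$. IV: $Q(A_\ell-KB_r),\ A^*_L,\ Q(B_\ell-K^{-1}A_r),\ B^*_L$. IVS: $Q(A_r-KB_\ell),\ A^*_R,\ Q(B_r-K^{-1}A_\ell),\ B^*_R$. IVT: $Q(B_\ell-K^{-1}A_r),\ B^*_L,\ Q(A_\ell-KB_r),\ A^*_L$. IVST: $Q(B_r-K^{-1}A_\ell),\ B^*_R,\ Q(A_r-KB_\ell),\ A^*_R$. *)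

theory Defs
  imports
    Complex_Main
    "HOL-Library.Poly_Mapping"
    "HOL-Library.Numeral_Type"
    "HOL-Algebra.QuotRing"
begin

section \<open>Free algebras\<close>

text \<open>
  Words over an alphabet form the free monoid under concatenation, written additively here because
  \<^typ>\<open>'k \<Rightarrow>\<^sub>0 'a\<close> is the monoid algebra of an additively written monoid. Thus
  \<^typ>\<open>'g list \<Rightarrow>\<^sub>0 'a\<close>, with its type class product, is the free algebra on \<^typ>\<open>'g\<close>,
  and \<^term>\<open>Poly_Mapping.lookup v w\<close> is the coefficient of the word \<^term>\<open>w\<close> in \<^term>\<open>v\<close>.
\<close>

instantiation list :: (type) monoid_add
begin
definition zero_list_def: "0 = []"
definition plus_list_def: "xs + ys = xs @ ys"
instance by standard (simp_all add: zero_list_def plus_list_def)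
end

definition smul :: "'a::field \<Rightarrow> ('k \<Rightarrow>\<^sub>0 'a) \<Rightarrow> ('k \<Rightarrow>\<^sub>0 'a)"  (infixr \<open>\<cdot>\<close> 75)
  where "c \<cdot> v = Poly_Mapping.map (\<lambda>x. c * x) v"

lemma lookup_smul [simp]: "Poly_Mapping.lookup (c \<cdot> v) k = c * Poly_Mapping.lookup v k"
  by (simp add: smul_def Poly_Mapping.map.rep_eq when_def)

lemma vector_space_smul: "vector_space (smul :: 'a::field \<Rightarrow> ('k \<Rightarrow>\<^sub>0 'a) \<Rightarrow> _)"
  by unfold_locales (auto intro!: poly_mapping_eqI simp: lookup_add algebra_simps)

definition word :: "'g list \<Rightarrow> ('g list \<Rightarrow>\<^sub>0 'a::field)"
  where "word w = Poly_Mapping.single w 1"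

definition gen :: "'g \<Rightarrow> ('g list \<Rightarrow>\<^sub>0 'a::field)"
  where "gen g = word [g]"

text \<open>The algebra homomorphism of the free algebra that sends each generator \<^term>\<open>g\<close> to \<^term>\<open>f g\<close>.\<close>

definition free_hom :: "('g \<Rightarrow> ('h list \<Rightarrow>\<^sub>0 'a::field)) \<Rightarrow> ('g list \<Rightarrow>\<^sub>0 'a) \<Rightarrow> ('h list \<Rightarrow>\<^sub>0 'a)"
  where "free_hom f v = (\<Sum>w\<in>Poly_Mapping.keys v. Poly_Mapping.lookup v w \<cdot> prod_list (map f w))"

section \<open>Algebras carried by subspaces, and skew derivations\<close>

definition linear_on :: "('k \<Rightarrow>\<^sub>0 'a::field) set \<Rightarrow> (('k \<Rightarrow>\<^sub>0 'a) \<Rightarrow> ('k \<Rightarrow>\<^sub>0 'a)) \<Rightarrow> bool"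
  where "linear_on S f \<longleftrightarrow> f ` S \<subseteq> S \<and>
    (\<forall>u\<in>S. \<forall>v\<in>S. f (u + v) = f u + f v) \<and> (\<forall>c. \<forall>u\<in>S. f (c \<cdot> u) = c \<cdot> f u)"

text \<open>Below, \<^term>\<open>S\<close> is the underlying space of the algebra and \<^term>\<open>m\<close> its product. An
  automorphism preserves the identity element because it is surjective and multiplicative.\<close>

definition algebra_automorphism ::
  "('k \<Rightarrow>\<^sub>0 'a::field) set \<Rightarrow> (('k \<Rightarrow>\<^sub>0 'a) \<Rightarrow> ('k \<Rightarrow>\<^sub>0 'a) \<Rightarrow> ('k \<Rightarrow>\<^sub>0 'a)) \<Rightarrow>
    (('k \<Rightarrow>\<^sub>0 'a) \<Rightarrow> ('k \<Rightarrow>\<^sub>0 'a)) \<Rightarrow> bool"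
  where "algebra_automorphism S m \<phi> \<longleftrightarrow> bij_betw \<phi> S S \<and> linear_on S \<phi> \<and>
    (\<forall>u\<in>S. \<forall>v\<in>S. \<phi> (m u v) = m (\<phi> u) (\<phi> v))"

definition skew_derivation ::
  "('k \<Rightarrow>\<^sub>0 'a::field) set \<Rightarrow> (('k \<Rightarrow>\<^sub>0 'a) \<Rightarrow> ('k \<Rightarrow>\<^sub>0 'a) \<Rightarrow> ('k \<Rightarrow>\<^sub>0 'a)) \<Rightarrow>
    (('k \<Rightarrow>\<^sub>0 'a) \<Rightarrow> ('k \<Rightarrow>\<^sub>0 'a)) \<Rightarrow> (('k \<Rightarrow>\<^sub>0 'a) \<Rightarrow> ('k \<Rightarrow>\<^sub>0 'a)) \<Rightarrow>
    (('k \<Rightarrow>\<^sub>0 'a) \<Rightarrow> ('k \<Rightarrow>\<^sub>0 'a)) \<Rightarrow> bool"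
  where "skew_derivation S m \<phi> \<psi> \<delta> \<longleftrightarrow>
    algebra_automorphism S m \<phi> \<and> algebra_automorphism S m \<psi> \<and> linear_on S \<delta> \<and>
    (\<forall>u\<in>S. \<forall>v\<in>S. \<delta> (m u v) = m (\<phi> u) (\<delta> v) + m (\<delta> u) (\<psi> v))"

section \<open>The algebra \<open>\<box>\<^sub>q\<close> and its modules\<close>

text \<open>The index set \<open>\<int>/4\<int>\<close> is the numeral type \<^typ>\<open>4\<close>, whose arithmetic is modulo 4.\<close>

definition three_q :: "'a::field \<Rightarrow> 'a"
  where "three_q q = (q ^ 3 - inverse q ^ 3) / (q - inverse q)"

definition free_ring :: "(4 list \<Rightarrow>\<^sub>0 'a::field) ring"
  where "free_ring = \<lparr>carrier = UNIV, mult = (*), one = 1, zero = 0, add = (+)\<rparr>"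

definition box_relators :: "'a::field \<Rightarrow> (4 list \<Rightarrow>\<^sub>0 'a) set"
  where "box_relators q =
    {inverse (q - inverse q) \<cdot> (q \<cdot> (gen i * gen (i + 1)) - inverse q \<cdot> (gen (i + 1) * gen i)) - 1
      | i. True} \<union>
    {gen i ^ 3 * gen (i + 2) - three_q q \<cdot> (gen i ^ 2 * gen (i + 2) * gen i)
       + three_q q \<cdot> (gen i * gen (i + 2) * gen i ^ 2) - gen (i + 2) * gen i ^ 3
      | i. True}"

definition box_ideal :: "'a::field \<Rightarrow> (4 list \<Rightarrow>\<^sub>0 'a) set"
  where "box_ideal q = genideal free_ring (box_relators q)"

definition box :: "'a::field \<Rightarrow> (4 list \<Rightarrow>\<^sub>0 'a) set ring"
  where "box q = free_ring Quot box_ideal q"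

definition box_gen :: "'a::field \<Rightarrow> 4 \<Rightarrow> (4 list \<Rightarrow>\<^sub>0 'a) set"
  where "box_gen q i = box_ideal q +>\<^bsub>free_ring\<^esub> gen i"

definition box_scalar :: "'a::field \<Rightarrow> 'a \<Rightarrow> (4 list \<Rightarrow>\<^sub>0 'a) set"
  where "box_scalar q c = box_ideal q +>\<^bsub>free_ring\<^esub> (c \<cdot> 1)"

text \<open>\<^term>\<open>\<rho> X v\<close> is the action of \<^term>\<open>X\<close> in \<^term>\<open>box q\<close> on the vector \<^term>\<open>v\<close>. The last clause
  says that the scalars of \<^term>\<open>box q\<close>, in particular its identity, act as scalars.\<close>

definition box_module ::
  "'a::field \<Rightarrow> ('k \<Rightarrow>\<^sub>0 'a) set \<Rightarrow> ((4 list \<Rightarrow>\<^sub>0 'a) set \<Rightarrow> ('k \<Rightarrow>\<^sub>0 'a) \<Rightarrow> ('k \<Rightarrow>\<^sub>0 'a)) \<Rightarrow> bool"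
  where "box_module q M \<rho> \<longleftrightarrow> Modules.module.subspace smul M \<and>
    (\<forall>X\<in>carrier (box q). linear_on M (\<rho> X)) \<and>
    (\<forall>X\<in>carrier (box q). \<forall>Y\<in>carrier (box q). \<forall>v\<in>M.
       \<rho> (X \<oplus>\<^bsub>box q\<^esub> Y) v = \<rho> X v + \<rho> Y v \<and>
       \<rho> (X \<otimes>\<^bsub>box q\<^esub> Y) v = \<rho> X (\<rho> Y v)) \<and>
    (\<forall>c. \<forall>v\<in>M. \<rho> (box_scalar q c) v = c \<cdot> v)"

section \<open>The free algebra on two generators\<close>

datatype letter = A | B

type_synonym 'a V = "letter list \<Rightarrow>\<^sub>0 'a"

definition form :: "'a::field V \<Rightarrow> 'a V \<Rightarrow> 'a"
  where "form u v = (\<Sum>w\<in>Poly_Mapping.keys u. Poly_Mapping.lookup u w * Poly_Mapping.lookup v w)"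

text \<open>The entry of the matrix of \<^term>\<open>X\<close> in row \<^term>\<open>w\<close> and column \<^term>\<open>v\<close> is the coefficient of
  \<^term>\<open>w\<close> in the image of \<^term>\<open>v\<close>.\<close>

definition End_V :: "('a::field V \<Rightarrow> 'a V) set"
  where "End_V = {X. Vector_Spaces.linear smul smul X \<and>
    (\<forall>w. finite {v. Poly_Mapping.lookup (X (word v)) w \<noteq> 0})}"

definition adj :: "('a::field V \<Rightarrow> 'a V) \<Rightarrow> ('a V \<Rightarrow> 'a V)"
  where "adj X = (THE Y. Y \<in> End_V \<and> (\<forall>u v. form (X u) v = form u (Y v)))"

definition K :: "'a::field \<Rightarrow> 'a V \<Rightarrow> 'a V"
  where "K q = free_hom (\<lambda>x. case x of A \<Rightarrow> q ^ 2 \<cdot> gen A | B \<Rightarrow> inverse q ^ 2 \<cdot> gen B)"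

definition K_inv :: "'a::field \<Rightarrow> 'a V \<Rightarrow> 'a V"
  where "K_inv q = inv_into UNIV (K q)"

definition mulL :: "letter \<Rightarrow> 'a::field V \<Rightarrow> 'a V"
  where "mulL x v = gen x * v"

definition mulR :: "letter \<Rightarrow> 'a::field V \<Rightarrow> 'a V"
  where "mulR x v = v * gen x"

section \<open>The \<open>q\<close>-shuffle algebra\<close>

definition pairing :: "letter \<Rightarrow> letter \<Rightarrow> int"
  where "pairing x y = (if x = y then 2 else -2)"

fun shuffle_word :: "'a::field \<Rightarrow> letter list \<Rightarrow> letter list \<Rightarrow> 'a V" where
  "shuffle_word q [] v = word v"
| "shuffle_word q (x # u) [] = word (x # u)"
| "shuffle_word q (x # u) (y # v) =
     gen x * shuffle_word q u (y # v) +
     (q powi (\<Sum>z\<leftarrow>x # u. pairing z y)) \<cdot> (gen y * shuffle_word q (x # u) v)"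

definition shuffle :: "'a::field \<Rightarrow> 'a V \<Rightarrow> 'a V \<Rightarrow> 'a V"
  where "shuffle q u v =
    (\<Sum>x\<in>Poly_Mapping.keys u. \<Sum>y\<in>Poly_Mapping.keys v.
       (Poly_Mapping.lookup u x * Poly_Mapping.lookup v y) \<cdot> shuffle_word q x y)"

definition shL :: "'a::field \<Rightarrow> letter \<Rightarrow> 'a V \<Rightarrow> 'a V"
  where "shL q x v = shuffle q (gen x) v"

definition shR :: "'a::field \<Rightarrow> letter \<Rightarrow> 'a V \<Rightarrow> 'a V"
  where "shR q x v = shuffle q v (gen x)"

definition shuffle_subalgebra :: "'a::field \<Rightarrow> 'a V set \<Rightarrow> bool"
  where "shuffle_subalgebra q S \<longleftrightarrow>
    Modules.module.subspace smul S \<and> 1 \<in> S \<and> (\<forall>u\<in>S. \<forall>v\<in>S. shuffle q u v \<in> S)"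

definition U :: "'a::field \<Rightarrow> 'a V set"
  where "U q = shuffle_subalgebra q hull {gen A, gen B}"

section \<open>The eight \<open>\<box>\<^sub>q\<close>-module structures on \<open>U\<close>\<close>

definition Q :: "'a::field \<Rightarrow> 'a"
  where "Q q = 1 - q ^ 2"

definition U_module_by ::
  "'a::field \<Rightarrow> ((4 list \<Rightarrow>\<^sub>0 'a) set \<Rightarrow> 'a V \<Rightarrow> 'a V) \<Rightarrow>
    ('a V \<Rightarrow> 'a V) \<Rightarrow> ('a V \<Rightarrow> 'a V) \<Rightarrow> ('a V \<Rightarrow> 'a V) \<Rightarrow> ('a V \<Rightarrow> 'a V) \<Rightarrow> bool"
  where "U_module_by q \<rho> f0 f1 f2 f3 \<longleftrightarrow> box_module q (U q) \<rho> \<and>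
    (\<forall>v\<in>U q. \<rho> (box_gen q 0) v = f0 v \<and> \<rho> (box_gen q 1) v = f1 v \<and>
             \<rho> (box_gen q 2) v = f2 v \<and> \<rho> (box_gen q 3) v = f3 v)"

datatype structure_type = III | IIIS | IIIT | IIIST | IV | IVS | IVT | IVST

fun U_module ::
  "'a::field \<Rightarrow> structure_type \<Rightarrow> ((4 list \<Rightarrow>\<^sub>0 'a) set \<Rightarrow> 'a V \<Rightarrow> 'a V) \<Rightarrow> bool" where
  "U_module q III \<rho> \<longleftrightarrow> U_module_by q \<rho>
     (shL q A) (\<lambda>v. Q q \<cdot> (adj (mulL A) v - adj (mulR B) (K q v)))
     (shL q B) (\<lambda>v. Q q \<cdot> (adj (mulL B) v - adj (mulR A) (K_inv q v)))"
| "U_module q IIIS \<rho> \<longleftrightarrow> U_module_by q \<rho>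
     (shR q A) (\<lambda>v. Q q \<cdot> (adj (mulR A) v - adj (mulL B) (K q v)))
     (shR q B) (\<lambda>v. Q q \<cdot> (adj (mulR B) v - adj (mulL A) (K_inv q v)))"
| "U_module q IIIT \<rho> \<longleftrightarrow> U_module_by q \<rho>
     (shL q B) (\<lambda>v. Q q \<cdot> (adj (mulL B) v - adj (mulR A) (K_inv q v)))
     (shL q A) (\<lambda>v. Q q \<cdot> (adj (mulL A) v - adj (mulR B) (K q v)))"
| "U_module q IIIST \<rho> \<longleftrightarrow> U_module_by q \<rho>
     (shR q B) (\<lambda>v. Q q \<cdot> (adj (mulR B) v - adj (mulL A) (K_inv q v)))
     (shR q A) (\<lambda>v. Q q \<cdot> (adj (mulR A) v - adj (mulL B) (K q v)))"
| "U_module q IV \<rho> \<longleftrightarrow> U_module_by q \<rho>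
     (\<lambda>v. Q q \<cdot> (shL q A v - K q (shR q B v))) (adj (mulL A))
     (\<lambda>v. Q q \<cdot> (shL q B v - K_inv q (shR q A v))) (adj (mulL B))"
| "U_module q IVS \<rho> \<longleftrightarrow> U_module_by q \<rho>
     (\<lambda>v. Q q \<cdot> (shR q A v - K q (shL q B v))) (adj (mulR A))
     (\<lambda>v. Q q \<cdot> (shR q B v - K_inv q (shL q A v))) (adj (mulR B))"
| "U_module q IVT \<rho> \<longleftrightarrow> U_module_by q \<rho>
     (\<lambda>v. Q q \<cdot> (shL q B v - K_inv q (shR q A v))) (adj (mulL B))
     (\<lambda>v. Q q \<cdot> (shL q A v - K q (shR q B v))) (adj (mulL A))"
| "U_module q IVST \<rho> \<longleftrightarrow> U_module_by q \<rho>
     (\<lambda>v. Q q \<cdot> (shR q B v - K_inv q (shL q A v))) (adj (mulR B))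
     (\<lambda>v. Q q \<cdot> (shR q A v - K q (shL q B v))) (adj (mulR A))"

end

theory Submission
  imports Defs
begin

text \<open>
  The adjoint of left (right) multiplication by a letter deletes that letter from the front (back)
  of a word. The recursion for the \<open>q\<close>-shuffle product, and its mirror image in the last letters,
  say precisely that these deletions are skew derivations: \<open>A\<^sup>*\<^sub>L\<close> and \<open>B\<^sup>*\<^sub>L\<close> are \<open>(K, I)\<close>- and
  \<open>(K\<^sup>-\<^sup>1, I)\<close>-derivations, \<open>A\<^sup>*\<^sub>R\<close> and \<open>B\<^sup>*\<^sub>R\<close> are \<open>(I, K)\<close>- and \<open>(I, K\<^sup>-\<^sup>1)\<close>-derivations. Composing
  with \<open>K\<^sup>\<plusminus>\<^sup>1\<close> turns \<open>B\<^sup>*\<^sub>R\<close> into the \<open>(K, I)\<close>-derivation \<open>B\<^sup>*\<^sub>R K\<close>, and so on, so the operators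
  of type III are differences of skew derivations of equal type.
\<close>

abbreviation coeff :: "('k \<Rightarrow>\<^sub>0 'a::zero) \<Rightarrow> 'k \<Rightarrow> 'a"
  where "coeff \<equiv> Poly_Mapping.lookup"

interpretation smul: vector_space "smul :: 'a::field \<Rightarrow> ('k \<Rightarrow>\<^sub>0 'a) \<Rightarrow> _"
  by (rule vector_space_smul)

section \<open>Words and bilinearity\<close>

lemma coeff_word: "coeff (word w) w' = (if w = w' then 1 else 0)"
  by (simp add: word_def lookup_single when_def)

text \<open>Finite support makes the words a spanning set; linear identities below are reduced to
  words by this rule.\<close>

lemma word_induct [case_names word add smul]:
  fixes v :: "'g list \<Rightarrow>\<^sub>0 'a::field"
  assumes w: "\<And>w. P (word w)" and a: "\<And>u v. P u \<Longrightarrow> P v \<Longrightarrow> P (u + v)"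
    and s: "\<And>c u. P u \<Longrightarrow> P (c \<cdot> u)"
  shows "P v"
proof (induction v rule: update_induct)
  case const
  have "P (0 \<cdot> word [])" by (intro s w)
  then show ?case by simp
next
  case (update f k c)
  \<comment> \<open>The key \<open>k\<close> is fresh for \<open>f\<close>, so overwriting its
    coefficient amounts to adding a multiple of a word.\<close>
  have "Poly_Mapping.update k c f = f + c \<cdot> word k"
    using update by (intro poly_mapping_eqI)
      (auto simp: lookup_update lookup_add coeff_word in_keys_iff)
  then show ?case by (simp add: a s w update)
qed

lemma word_mult_word [simp]: "(word u :: 'g list \<Rightarrow>\<^sub>0 'a::field) * word v = word (u @ v)"
  by (simp add: word_def mult_single plus_list_def)

lemma gen_mult_word [simp]: "(gen x :: 'g list \<Rightarrow>\<^sub>0 'a::field) * word w = word (x # w)"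
  and word_mult_gen [simp]: "(word w :: 'g list \<Rightarrow>\<^sub>0 'a::field) * gen x = word (w @ [x])"
  by (simp_all add: gen_def)

lemma word_Nil: "word [] = 1"
  by (simp add: word_def zero_list_def[symmetric])

lemma smul_mult_left [simp]: "(c \<cdot> u) * v = c \<cdot> (u * v)" for u :: "'g list \<Rightarrow>\<^sub>0 'a::field"
  by (simp add: smul_def mult_map_scale_conv_mult mult.assoc)

lemma smul_mult_right [simp]: "u * (c \<cdot> v) = c \<cdot> (u * v)" for u :: "'g list \<Rightarrow>\<^sub>0 'a::field"
proof (induction u rule: word_induct)
  case (word w)
  show ?case
  proof (induction v arbitrary: c rule: word_induct)
    case (word w')
    have "c \<cdot> word k = Poly_Mapping.single k c" for k :: "'g list"
      by (intro poly_mapping_eqI) (simp add: coeff_word lookup_single when_def)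
    then show ?case by (simp add: word_def mult_single)
  next
    case (smul d v)
    then show ?case by simp
  qed (simp add: smul.scale_right_distrib distrib_left)
qed (simp_all add: smul.scale_right_distrib distrib_right smul.scale_left_commute)

section \<open>Bilinearity of the \<open>q\<close>-shuffle product\<close>

lemma shuffle_word_word [simp]: "shuffle q (word u) (word v) = shuffle_word q u v"
  by (simp add: shuffle_def word_def)

text \<open>The defining sum runs over supports, which change under addition and scaling; over
  common finite index sets the extra terms vanish and linearity can be checked termwise.\<close>

lemma shuffle_superset:
  assumes "finite X" "Poly_Mapping.keys u \<subseteq> X" "finite Y" "Poly_Mapping.keys v \<subseteq> Y"
  shows "shuffle q u v = (\<Sum>x\<in>X. \<Sum>y\<in>Y. (coeff u x * coeff v y) \<cdot> shuffle_word q x y)"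
proof -
  have "(\<Sum>y\<in>Y. (coeff u x * coeff v y) \<cdot> shuffle_word q x y) =
      (\<Sum>y\<in>Poly_Mapping.keys v. (coeff u x * coeff v y) \<cdot> shuffle_word q x y)" for x
    using assms by (intro sum.mono_neutral_right) (auto simp: in_keys_iff)
  moreover have "(\<Sum>x\<in>X. \<Sum>y\<in>Poly_Mapping.keys v. (coeff u x * coeff v y) \<cdot> shuffle_word q x y) = shuffle q u v"
    unfolding shuffle_def
    using assms by (intro sum.mono_neutral_right) (auto simp: in_keys_iff)
  ultimately show ?thesis by simp
qed

lemma shuffle_add_left: "shuffle q (u + u') v = shuffle q u v + shuffle q u' v"
proof -
  let ?X = "Poly_Mapping.keys u \<union> Poly_Mapping.keys u'"
  show ?thesis
    using keys_add[of u u']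
    by (simp add: shuffle_superset[of ?X _ "Poly_Mapping.keys v"] lookup_add distrib_right
        smul.scale_left_distrib sum.distrib)
qed

lemma shuffle_add_right: "shuffle q u (v + v') = shuffle q u v + shuffle q u v'"
proof -
  let ?Y = "Poly_Mapping.keys v \<union> Poly_Mapping.keys v'"
  show ?thesis
    using keys_add[of v v']
    by (simp add: shuffle_superset[of "Poly_Mapping.keys u" _ ?Y] lookup_add distrib_left
        smul.scale_left_distrib sum.distrib)
qed

lemma keys_smul_subset: "Poly_Mapping.keys (c \<cdot> u) \<subseteq> Poly_Mapping.keys u"
  by (auto simp: in_keys_iff)

lemma shuffle_smul_left [simp]: "shuffle q (c \<cdot> u) v = c \<cdot> shuffle q u v"
  using keys_smul_subset[of c u]
  by (simp add: shuffle_superset[of "Poly_Mapping.keys u" _ "Poly_Mapping.keys v"] smul.scale_sum_right mult.assoc)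

lemma shuffle_smul_right [simp]: "shuffle q u (c \<cdot> v) = c \<cdot> shuffle q u v"
  using keys_smul_subset[of c v]
  by (simp add: shuffle_superset[of "Poly_Mapping.keys u" _ "Poly_Mapping.keys v"] smul.scale_sum_right mult.left_commute)

lemma shuffle_zero_left [simp]: "shuffle q 0 v = 0"
  and shuffle_zero_right [simp]: "shuffle q v 0 = 0"
  by (simp_all add: shuffle_def)

lemma shuffle_diff_left: "shuffle q (u - u') v = shuffle q u v - shuffle q u' v"
  using shuffle_add_left[of q "u - u'" u' v] by simp

lemma shuffle_diff_right: "shuffle q u (v - v') = shuffle q u v - shuffle q u v'"
  using shuffle_add_right[of q u "v - v'" v'] by simp

lemma shuffle_word_Nil_right [simp]: "shuffle_word q u [] = word u"
  by (cases u) simp_all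

section \<open>Deletion of end letters\<close>

text \<open>Pulling coefficients back along the injective map \<open>Cons x\<close> strips a leading
  \<open>x\<close> and sends every other word, the empty one included, to 0.\<close>

definition delL :: "letter \<Rightarrow> 'a::field V \<Rightarrow> 'a V"
  where "delL x = Poly_Mapping.map_key (Cons x)"

definition delR :: "letter \<Rightarrow> 'a::field V \<Rightarrow> 'a V"
  where "delR x = Poly_Mapping.map_key (\<lambda>w. w @ [x])"

lemma coeff_delL [simp]: "coeff (delL x v) w = coeff v (x # w)"
  by (simp add: delL_def map_key.rep_eq)

lemma coeff_delR [simp]: "coeff (delR x v) w = coeff v (w @ [x])"
  by (simp add: delR_def map_key.rep_eq inj_on_def)

lemma delL_add [simp]: "delL x (u + v) = delL x u + delL x v"
  and delR_add [simp]: "delR x (u + v) = delR x u + delR x v"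
  and delL_smul [simp]: "delL x (c \<cdot> u) = c \<cdot> delL x u"
  and delR_smul [simp]: "delR x (c \<cdot> u) = c \<cdot> delR x u"
  by (auto intro!: poly_mapping_eqI simp: lookup_add)

lemma delL_gen_mult [simp]: "delL x (gen y * v) = (if x = y then v else 0)"
proof (induction v rule: word_induct)
  case (word w)
  show ?case by (intro poly_mapping_eqI) (auto simp: coeff_word)
qed (auto simp: distrib_left)

lemma delR_mult_gen [simp]: "delR x (v * gen y) = (if x = y then v else 0)"
proof (induction v rule: word_induct)
  case (word w)
  show ?case by (intro poly_mapping_eqI) (auto simp: coeff_word)
qed (auto simp: distrib_right)

lemma delL_Cons [simp]: "delL x (word (y # w)) = (if x = y then word w else 0)"
  using delL_gen_mult[of x y "word w"] by simp

lemma delR_snoc [simp]: "delR x (word (w @ [y])) = (if x = y then word w else 0)"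
  using delR_mult_gen[of x "word w" y] by simp

lemma delL_Nil [simp]: "delL x (word []) = 0"
  and delR_Nil [simp]: "delR x (word []) = 0"
  by (auto intro!: poly_mapping_eqI simp: coeff_word)

section \<open>Deletions as adjoints of multiplication by a letter\<close>

text \<open>Pairing with a word reads off a coefficient, so an adjoint is unique and the
  \<open>THE\<close> in \<open>adj\<close> denotes it.\<close>

lemma adj_eqI:
  assumes "Y \<in> End_V" "\<And>u v. form (X u) v = form u (Y v)"
  shows "adj X = Y"
  unfolding adj_def
proof (rule the_equality)
  fix Z assume Z: "Z \<in> End_V \<and> (\<forall>u v. form (X u) v = form u (Z v))"
  have "coeff (Z v) w = coeff (Y v) w" for v w
  proof -
    have "form (word w) (Z v) = form (word w) (Y v)" using Z assms by metis
    then show ?thesis by (simp add: form_def word_def)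
  qed
  then show "Z = Y" by (intro ext poly_mapping_eqI)
qed (use assms in auto)

text \<open>Here \<open>u'\<close> is the pushforward of \<open>u\<close> along \<open>f\<close> and
  \<open>v'\<close> the pullback of \<open>v\<close>; reindexing by \<open>f\<close> matches the two
  sums. With \<open>f\<close> prepending or appending a letter, this is the adjointness of
  multiplication and deletion.\<close>

lemma form_injective:
  assumes "inj f" "\<And>w. coeff u' (f w) = coeff u w" "\<And>w. w \<notin> range f \<Longrightarrow> coeff u' w = 0"
    and "\<And>w. coeff v' w = coeff v (f w)"
  shows "form u' v = form u v'"
proof -
  have "w \<in> Poly_Mapping.keys u' \<longleftrightarrow> w \<in> f ` Poly_Mapping.keys u" for w
  proof (cases "w \<in> range f")
    case True
    then obtain w' where "w = f w'" by blast
    then show ?thesis using assms(1,2) by (simp add: in_keys_iff inj_image_mem_iff)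
  qed (use assms(3) in \<open>auto simp: in_keys_iff\<close>)
  then have "Poly_Mapping.keys u' = f ` Poly_Mapping.keys u" by blast
  then have "form u' v = (\<Sum>w\<in>Poly_Mapping.keys u. coeff u' (f w) * coeff v (f w))"
    using assms(1) unfolding form_def by (simp add: sum.reindex inj_on_def)
  then show ?thesis by (simp add: form_def assms(2,4))
qed

lemma coeff_gen_mult:
  "coeff (gen x * v) w = (case w of [] \<Rightarrow> 0 | y # w' \<Rightarrow> if x = y then coeff v w' else 0)"
  for v :: "'g list \<Rightarrow>\<^sub>0 'a::field"
  by (induction v rule: word_induct)
    (auto simp: coeff_word distrib_left lookup_add split: list.split)

lemma coeff_mult_gen_Nil: "coeff (v * gen x) [] = 0"
  and coeff_mult_gen_snoc: "coeff (v * gen x) (w @ [y]) = (if x = y then coeff v w else 0)"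
  for v :: "'g list \<Rightarrow>\<^sub>0 'a::field"
  by (induction v rule: word_induct) (auto simp: coeff_word distrib_right lookup_add)

text \<open>For row finiteness: row \<open>w\<close> of \<open>delL x\<close> is row
  \<open>x # w\<close> of the identity matrix, and similarly for \<open>delR x\<close>.\<close>

lemma finite_coeff_word: "finite {v. coeff (word v :: 'g list \<Rightarrow>\<^sub>0 'a::field) w \<noteq> 0}"
  by (rule finite_subset[of _ "{w}"]) (auto simp: coeff_word)

lemma adj_mulL: "adj (mulL x) = (delL x :: 'a::field V \<Rightarrow> _)"
proof (rule adj_eqI)
  have "Vector_Spaces.linear smul smul (delL x :: 'a V \<Rightarrow> _)"
    by unfold_locales (simp_all add: smul.scale_right_distrib smul.scale_left_distrib)
  then show "delL x \<in> (End_V :: ('a V \<Rightarrow> _) set)"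
    by (simp add: End_V_def finite_coeff_word)
  fix u v :: "'a V"
  show "form (mulL x u) v = form u (delL x v)"
    by (rule form_injective[of "Cons x"])
      (auto simp: mulL_def coeff_gen_mult split: list.split)
qed

lemma adj_mulR: "adj (mulR x) = (delR x :: 'a::field V \<Rightarrow> _)"
proof (rule adj_eqI)
  have "Vector_Spaces.linear smul smul (delR x :: 'a V \<Rightarrow> _)"
    by unfold_locales (simp_all add: smul.scale_right_distrib smul.scale_left_distrib)
  then show "delR x \<in> (End_V :: ('a V \<Rightarrow> _) set)"
    by (simp add: End_V_def finite_coeff_word)
  fix u v :: "'a V"
  have "coeff (mulR x u) w = 0" if "w \<notin> range (\<lambda>w. w @ [x])" for w
    using that by (cases w rule: rev_cases) (auto simp: mulR_def coeff_mult_gen_Nil coeff_mult_gen_snoc)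
  then show "form (mulR x u) v = form u (delR x v)"
    by (intro form_injective[of "\<lambda>w. w @ [x]"])
      (auto simp: mulR_def coeff_mult_gen_snoc inj_on_def)
qed

section \<open>The twist automorphisms\<close>

text \<open>The exponent of \<open>q\<close> that \<open>x\<close> picks up in the shuffle recursion
  on moving past \<open>w\<close>. It is also the exponent in the eigenvalue at \<open>w\<close> of
  \<open>K\<close> (for \<open>x = A\<close>) or of its inverse (for \<open>x = B\<close>), which is
  why the product rules for deletion are twisted by these maps.\<close>

definition weight :: "letter \<Rightarrow> letter list \<Rightarrow> int"
  where "weight x w = (\<Sum>z\<leftarrow>w. pairing z x)"

lemma weight_simps [simp]:
  "weight x [] = 0" "weight x (y # w) = pairing y x + weight x w"
  "weight x (w @ w') = weight x w + weight x w'"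
  by (simp_all add: weight_def)

lemma weight_B: "weight B w = - weight A w"
proof -
  have "pairing z B = - pairing z A" for z
    by (cases z) (simp_all add: pairing_def)
  then show ?thesis by (induction w) simp_all
qed

text \<open>\<^term>\<open>twist q x\<close> multiplies a word \<^term>\<open>w\<close> by \<^term>\<open>q powi weight x w\<close>; this makes the
  two letters, and with them \<open>K\<close> and \<open>K\<^sup>-\<^sup>1\<close>, interchangeable.\<close>

definition twist :: "'a::field \<Rightarrow> letter \<Rightarrow> 'a V \<Rightarrow> 'a V"
  where "twist q x = (case x of A \<Rightarrow> K q | B \<Rightarrow> K_inv q)"

text \<open>\<open>K\<close> is diagonal in the word basis: a word goes to the product of its scaled
  letters, and the scalars, with exponents \<open>pairing z A\<close>, collect into the
  weight.\<close>

lemma coeff_K: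
  assumes "q \<noteq> 0"
  shows "coeff (K q v) w = q powi weight A w * coeff v w"
proof -
  let ?f = "\<lambda>x. case x of A \<Rightarrow> q ^ 2 \<cdot> gen A | B \<Rightarrow> inverse q ^ 2 \<cdot> gen B"
  have "q powi (-2 + k) = inverse q ^ 2 * q powi k" for k
    using assms power_int_add[of q "-2" k] by (simp add: power_int_minus power_inverse)
  moreover have "q powi (2 + k) = q ^ 2 * q powi k" for k
    using assms by (simp add: power_int_add)
  ultimately have prod: "prod_list (map ?f u) = q powi weight A u \<cdot> word u" for u
    by (induction u) (auto simp: word_Nil pairing_def mult.commute split: letter.split)
  have "coeff (K q v) w =
      (\<Sum>u\<in>Poly_Mapping.keys v. if u = w then coeff v u * q powi weight A u else 0)"
    unfolding K_def free_hom_def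
    by (simp add: prod lookup_sum coeff_word if_distrib mult.assoc cong: if_cong)
  then show ?thesis by (auto simp: in_keys_iff)
qed

text \<open>Inverting \<open>q\<close> inverts every diagonal entry of \<open>K\<close>, so both
  composites are the identity.\<close>

lemma K_inv_eq:
  assumes "q \<noteq> 0"
  shows "K_inv q = K (inverse q)"
  unfolding K_inv_def
  using assms by (intro inv_equality poly_mapping_eqI)
    (simp_all add: coeff_K power_int_inverse mult.assoc[symmetric] power_int_eq_0_iff)

lemma coeff_twist:
  "q \<noteq> 0 \<Longrightarrow> coeff (twist q x v) w = q powi weight x w * coeff v w"
  by (cases x) (simp_all add: twist_def K_inv_eq coeff_K weight_B power_int_inverse power_int_minus)

context
  fixes q :: "'a::field"
  assumes q: "q \<noteq> 0"
begin

lemma twist_word [simp]: "twist q x (word w) = q powi weight x w \<cdot> word w"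
  by (intro poly_mapping_eqI) (auto simp: coeff_twist q coeff_word)

lemma twist_add [simp]: "twist q x (u + v) = twist q x u + twist q x v"
  and twist_smul [simp]: "twist q x (c \<cdot> u) = c \<cdot> twist q x u"
  and twist_gen_mult [simp]: "twist q x (gen y * u) = q powi pairing y x \<cdot> (gen y * twist q x u)"
  by (auto intro!: poly_mapping_eqI
      simp: coeff_twist q coeff_gen_mult lookup_add algebra_simps power_int_add split: list.split)

lemma twist_inverse: "x \<noteq> y \<Longrightarrow> twist q x (twist q y v) = v"
  by (cases x; cases y) (auto intro!: poly_mapping_eqI
    simp: coeff_twist q weight_B power_int_minus)

section \<open>Twists and deletions applied to \<open>q\<close>-shuffle products\<close>

text \<open>All words occurring in the product are rearrangements of \<open>u @ v\<close>, so they
  share its weight.\<close>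

lemma twist_shuffle_word:
  "twist q x (shuffle_word q u v) = q powi weight x (u @ v) \<cdot> shuffle_word q u v"
  by (induction q\<equiv>q u v rule: shuffle_word.induct)
    (simp_all add: q power_int_add smul.scale_right_distrib ac_simps)

lemma twist_shuffle: "twist q x (shuffle q u v) = shuffle q (twist q x u) (twist q x v)"
proof (induction u rule: word_induct)
  case (word w)
  show ?case
    by (induction v rule: word_induct)
      (simp_all add: twist_shuffle_word q power_int_add shuffle_add_right mult.commute)
qed (simp_all add: shuffle_add_left)

text \<open>With the exponent folded into \<open>weight\<close>, the recursion matches the
  eigenvalues of \<open>twist\<close>; it replaces the raw equation as the rewriting rule.\<close>

lemma shuffle_word_Cons:
  "shuffle_word q (x # u) (y # v) = gen x * shuffle_word q u (y # v) +
     q powi weight y (x # u) \<cdot> (gen y * shuffle_word q (x # u) v)"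
  by (simp add: weight_def)

declare shuffle_word.simps(3) [simp del]

lemma pairing_commute: "pairing x y = pairing y x"
  by (simp add: pairing_def)

text \<open>The weight is now that of the second word: its letters all move past \<^term>\<open>x\<close>.\<close>

lemma shuffle_word_snoc:
  "shuffle_word q (u @ [x]) (v @ [y]) = shuffle_word q (u @ [x]) v * gen y +
     q powi weight x (v @ [y]) \<cdot> (shuffle_word q u (v @ [y]) * gen x)"
\<comment> \<open>The recursion at the front charges a letter of the second word for passing the
  first, the one at the end a letter of the first word for passing the second; symmetry of
  \<open>pairing\<close> reconciles them.\<close>
proof (induction u arbitrary: v)
  case Nil
  show ?case
  proof (induction v)
    case (Cons b v)
    then show ?case
      by (simp add: shuffle_word_Cons pairing_commute q power_int_add smul.scale_right_distrib algebra_simps)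
  qed (simp add: shuffle_word_Cons pairing_commute)
next
  case (Cons a u)
  \<comment> \<open>For \<open>v\<close> of the form \<open>b # v\<close>, the front recursion
    leaves a term with a shorter first word, expanded by \<open>outer\<close>, and one with a
    shorter second word, expanded by the inner hypothesis.\<close>
  note outer = this
  show ?case
  proof (induction v)
    case Nil
    show ?case using outer[of "[]"]
      by (simp add: shuffle_word_Cons pairing_commute q power_int_add smul.scale_right_distrib algebra_simps)
  next
    case (Cons b v)
    then show ?case using outer[of "b # v"]
      by (simp add: shuffle_word_Cons pairing_commute q power_int_add smul.scale_right_distrib algebra_simps)
  qed
qed


text \<open>For nonempty words, the two summands of the recursion begin with the first letters of
  \<open>u\<close> and of \<open>v\<close>; deletion keeps those that begin with \<open>x\<close>,
  and the power of \<open>q\<close> on the second is the eigenvalue of \<open>twist q x\<close> at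
  \<open>u\<close>.\<close>

lemma delL_shuffle:
  "delL x (shuffle q u v) = shuffle q (twist q x u) (delL x v) + shuffle q (delL x u) v"
proof (induction u rule: word_induct)
  case (word u)
  show ?case
  proof (induction v rule: word_induct)
    case (word v)
    show ?case
      by (cases u; cases v) (auto simp: shuffle_word_Cons)
  qed (simp_all add: shuffle_add_right smul.scale_right_distrib)
qed (simp_all add: shuffle_add_left smul.scale_right_distrib)

text \<open>The same argument with \<open>shuffle_word_snoc\<close>, whose power of \<open>q\<close>
  is the eigenvalue at the second word, so the twist falls on \<open>v\<close>.\<close>

lemma delR_shuffle:
  "delR x (shuffle q u v) = shuffle q u (delR x v) + shuffle q (delR x u) (twist q x v)"
proof (induction u rule: word_induct)
  case (word u)
  show ?case
  proof (induction v rule: word_induct)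
    case (word v)
    show ?case
      by (cases u rule: rev_cases; cases v rule: rev_cases) (auto simp: shuffle_word_snoc)
  qed (simp_all add: shuffle_add_right smul.scale_right_distrib)
qed (simp_all add: shuffle_add_left smul.scale_right_distrib)

section \<open>The subalgebra \<open>U\<close>\<close>

text \<open>Subalgebras are closed under intersection, so the hull is itself one.\<close>

lemma shuffle_subalgebra_U: "shuffle_subalgebra q (U q)"
  unfolding U_def
  by (rule hull_in) (auto simp: shuffle_subalgebra_def intro!: smul.subspace_Inter)

lemma twist_one [simp]: "twist q x 1 = 1"
  using twist_word[of x "[]"] by (simp add: word_Nil)

text \<open>The preimage of \<open>U q\<close> under the twist is a subalgebra, and it contains the
  generators because they are eigenvectors.\<close>

lemma twist_in_U:
  assumes "v \<in> U q"
  shows "twist q x v \<in> U q"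
proof -
  have "U q \<subseteq> {v. twist q x v \<in> U q}"
  proof (subst (1) U_def, rule hull_minimal)
    have "c \<cdot> gen a \<in> U q" for c a
    proof -
      have "{gen A, gen B} \<subseteq> U q"
        unfolding U_def by (rule hull_subset)
      then show ?thesis
        using shuffle_subalgebra_U by (cases a) (auto simp: shuffle_subalgebra_def smul.subspace_def)
    qed
    then show "{gen A, gen B} \<subseteq> {v. twist q x v \<in> U q}"
      by (simp add: gen_def)
    \<comment> \<open>The instance of \<open>twist_smul\<close> at scalar 0 says that the twist
      fixes the zero vector.\<close>
    show "shuffle_subalgebra q {v. twist q x v \<in> U q}"
      using shuffle_subalgebra_U twist_smul[of x 0 0]
      by (simp add: shuffle_subalgebra_def smul.subspace_def twist_shuffle)
  qed
  then show ?thesis using assms by blast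
qed

text \<open>The twist for the other letter also preserves \<open>U q\<close> and is the two-sided
  inverse.\<close>

lemma algebra_automorphism_twist: "algebra_automorphism (U q) (shuffle q) (twist q x)"
proof -
  obtain y where "x \<noteq> y" by (metis letter.distinct(1))
  then have "bij_betw (twist q x) (U q) (U q)"
    by (intro bij_betwI[of _ _ _ "twist q y"]) (auto simp: twist_in_U twist_inverse)
  then show ?thesis
    by (auto simp: algebra_automorphism_def linear_on_def twist_in_U twist_shuffle)
qed

end

section \<open>From product rules to skew derivations on the modules\<close>

lemma algebra_automorphism_id: "algebra_automorphism S m id"
  by (simp add: algebra_automorphism_def linear_on_def)

text \<open>Linearity and invariance of the space come from the module axioms, once the coset
  \<open>box_gen q i\<close> is seen to lie in the carrier.\<close>

lemma linear_on_box_gen: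
  assumes "box_module q M \<rho>"
  shows "linear_on M (\<rho> (box_gen q i))"
proof -
  have "box_gen q i \<in> carrier (box q)"
    by (auto simp: box_gen_def box_def FactRing_def A_RCOSETS_def' a_r_coset_def' free_ring_def)
  then show ?thesis using assms by (simp add: box_module_def)
qed

text \<open>Transfers a product rule valid on the whole shuffle algebra to the action:
  \<open>U q\<close> is closed under the product, so \<open>\<rho>\<close> agrees with
  \<open>\<delta>\<close> at both factors and at their product.\<close>

lemma skew_derivation_box_gen:
  assumes q: "q \<noteq> 0" and "box_module q (U q) \<rho>"
    and "\<And>v. v \<in> U q \<Longrightarrow> \<rho> (box_gen q i) v = \<delta> v"
    and "algebra_automorphism (U q) (shuffle q) \<phi>" "algebra_automorphism (U q) (shuffle q) \<psi>"
    and "\<And>u v. \<delta> (shuffle q u v) = shuffle q (\<phi> u) (\<delta> v) + shuffle q (\<delta> u) (\<psi> v)"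
  shows "skew_derivation (U q) (shuffle q) \<phi> \<psi> (\<rho> (box_gen q i))"
  using assms linear_on_box_gen[of q "U q" \<rho> i] shuffle_subalgebra_U[OF q]
  by (auto simp: skew_derivation_def shuffle_subalgebra_def)

text \<open>Applying \<open>delR y\<close> to the twisted product leaves
  \<open>twist q y (twist q x v)\<close> on the right factor, which is \<open>v\<close> since the
  letters differ. \<open>x = A\<close> and \<open>x = B\<close> give the actions of
  \<open>x_1\<close> and \<open>x_3\<close> in type III.\<close>

lemma shuffle_derivation_L:
  assumes "q \<noteq> 0" "x \<noteq> y"
  defines "\<delta> \<equiv> \<lambda>v. Q q \<cdot> (delL x v - delR y (twist q x v))"
  shows "\<delta> (shuffle q u v) = shuffle q (twist q x u) (\<delta> v) + shuffle q (\<delta> u) v"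
  using assms
  by (simp add: delL_shuffle delR_shuffle twist_shuffle twist_inverse shuffle_diff_left
      shuffle_diff_right algebra_simps smul.scale_right_distrib smul.scale_right_diff_distrib)

text \<open>The mirror image, for type IIIS: here the two twists cancel on the left factor.\<close>

lemma shuffle_derivation_R:
  assumes "q \<noteq> 0" "x \<noteq> y"
  defines "\<delta> \<equiv> \<lambda>v. Q q \<cdot> (delR x v - delL y (twist q x v))"
  shows "\<delta> (shuffle q u v) = shuffle q u (\<delta> v) + shuffle q (\<delta> u) (twist q x v)"
  using assms
  by (simp add: delL_shuffle delR_shuffle twist_shuffle twist_inverse shuffle_diff_left
      shuffle_diff_right algebra_simps smul.scale_right_distrib smul.scale_right_diff_distrib)

theorem theorem1p4:
  fixes q :: "'a::field"
  assumes "q \<noteq> 0" and "\<forall>n>0. q ^ n \<noteq> 1"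
  shows "(\<forall>t\<in>{III, IV}. \<forall>\<rho>. U_module q t \<rho> \<longrightarrow>
            skew_derivation (U q) (shuffle q) (K q) id (\<rho> (box_gen q 1)) \<and>
            skew_derivation (U q) (shuffle q) (K_inv q) id (\<rho> (box_gen q 3))) \<and>
         (\<forall>t\<in>{IIIS, IVS}. \<forall>\<rho>. U_module q t \<rho> \<longrightarrow>
            skew_derivation (U q) (shuffle q) id (K q) (\<rho> (box_gen q 1)) \<and>
            skew_derivation (U q) (shuffle q) id (K_inv q) (\<rho> (box_gen q 3))) \<and>
         (\<forall>t\<in>{IIIT, IVT}. \<forall>\<rho>. U_module q t \<rho> \<longrightarrow>
            skew_derivation (U q) (shuffle q) (K_inv q) id (\<rho> (box_gen q 1)) \<and>
            skew_derivation (U q) (shuffle q) (K q) id (\<rho> (box_gen q 3))) \<and>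
         (\<forall>t\<in>{IIIST, IVST}. \<forall>\<rho>. U_module q t \<rho> \<longrightarrow>
            skew_derivation (U q) (shuffle q) id (K_inv q) (\<rho> (box_gen q 1)) \<and>
            skew_derivation (U q) (shuffle q) id (K q) (\<rho> (box_gen q 3)))"
proof -
  note q = assms(1)
  have twist: "K q = twist q A" "K_inv q = twist q B"
    by (simp_all add: twist_def)
  note automorphism = algebra_automorphism_twist[OF q] algebra_automorphism_id
  \<comment> \<open>Up to the choice of letters only four operators occur: \<open>L\<close> serves
    III and IIIT, \<open>L'\<close> serves IV and IVT, \<open>R\<close> serves IIIS and IIIST,
    \<open>R'\<close> serves IVS and IVST.\<close>
  have L: "skew_derivation (U q) (shuffle q) (twist q x) id (\<rho> (box_gen q i))"
    if "box_module q (U q) \<rho>" "x \<noteq> y"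
      "\<forall>v\<in>U q. \<rho> (box_gen q i) v = Q q \<cdot> (delL x v - delR y (twist q x v))"
    for \<rho> i x y
    by (rule skew_derivation_box_gen[OF q that(1) bspec[OF that(3)] automorphism])
      (assumption, unfold id_apply, rule shuffle_derivation_L[OF q that(2)])
  have L': "skew_derivation (U q) (shuffle q) (twist q x) id (\<rho> (box_gen q i))"
    if "box_module q (U q) \<rho>" "\<forall>v\<in>U q. \<rho> (box_gen q i) v = delL x v" for \<rho> i x
    by (rule skew_derivation_box_gen[OF q that(1) bspec[OF that(2)] automorphism])
      (assumption, unfold id_apply, rule delL_shuffle[OF q])
  have R: "skew_derivation (U q) (shuffle q) id (twist q x) (\<rho> (box_gen q i))"
    if "box_module q (U q) \<rho>" "x \<noteq> y"
      "\<forall>v\<in>U q. \<rho> (box_gen q i) v = Q q \<cdot> (delR x v - delL y (twist q x v))"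
    for \<rho> i x y
    by (rule skew_derivation_box_gen[OF q that(1) bspec[OF that(3)] automorphism(2,1)])
      (assumption, unfold id_apply, rule shuffle_derivation_R[OF q that(2)])
  have R': "skew_derivation (U q) (shuffle q) id (twist q x) (\<rho> (box_gen q i))"
    if "box_module q (U q) \<rho>" "\<forall>v\<in>U q. \<rho> (box_gen q i) v = delR x v" for \<rho> i x
    by (rule skew_derivation_box_gen[OF q that(1) bspec[OF that(2)] automorphism(2,1)])
      (assumption, unfold id_apply, rule delR_shuffle[OF q])
  \<comment> \<open>In \<open>L\<close> and \<open>R\<close> the letter \<open>y\<close> occurs only
    in the premises, so both ordered pairs of distinct letters are supplied.\<close>
  show ?thesis
    unfolding twist
    by (auto simp: U_module_by_def twist adj_mulL adj_mulR
        intro: L[where x = A and y = B] L[where x = B and y = A] L'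
          R[where x = A and y = B] R[where x = B and y = A] R')
qed

end
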